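(* For any user locations $\mathbf u_k=[x_k,y_k,0]^{\mathsf T}$, $k\in\{1,2\}$, with $x_1\le x_2$, the single-pinch uplink TDMA rate region is contained in the single-pinch uplink FDMA rate region: $\mathcal R_{\mathrm{S},\mathrm{T}}^{\mathrm U}\subseteq\mathcal R_{\mathrm{S},\mathrm{F}}^{\mathrm U}$.
   Context: Let $\eta,\sigma^2,d,P_1,P_2>0$ and $y_{\mathrm p}\in\mathbb R$ be constants, and set $d_k^2=d^2+(y_k-y_{\mathrm p})^2$, $\gamma_k=\frac{P_k\eta}{d_k^2\sigma^2}$ for $k\in\{1,2\}$. TDMA region: $$\mathcal R_{\mathrm S,\mathrm T}^{\mathrm U}=\bigcup_{\rho\in[0,1]}\{(R_1,R_2):0\le R_1\le\rho\log_2(1+\gamma_1),\ 0\le R_2\le(1-\rho)\log_2(1+\gamma_2)\}.$$ FDMA region: for $q\in\mathbb R$ and $\rho\in[0,1]$ let $$r_1^{\rho}(q)=\rho\log_2\!\left(1+\frac{\eta P_1/(\rho\sigma^2)}{d_1^2+(q-x_1)^2}\right),\qquad r_2^{\rho}(q)=(1-\rho)\log_2\!\left(1+\frac{\eta P_2/((1-\rho)\sigma^2)}{d_2^2+(q-x_2)^2}\right),$$ with $r_1^0\equiv0$, $r_2^1\equiv0$. Let $\mathcal R_{\mathrm S,\mathrm F}^{\mathrm U}(q)=\bigcup_{\rho\in[0,1]}\{(R_1,R_2):0\le R_k\le r_k^\rho(q),\ k=1,2\}$ and $$\mathcal R_{\mathrm S,\mathrm F}^{\mathrm U}=\mathrm{Conv}\Big(\bigcup_{q\in[x_1,x_2]}\mathcal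 R_{\mathrm S,\mathrm F}^{\mathrm U}(q)\Big),$$ where $\mathrm{Conv}$ denotes the convex hull. *)

theory Defs
  imports "HOL-Analysis.Analysis"
begin

definition user_location :: "real \<Rightarrow> real \<Rightarrow> real ^ 3" where
  "user_location x y = vector [x, y, 0]"

text \<open>
  The square \<open>d\<^sub>k\<^sup>2 = d\<^sup>2 + (y\<^sub>k - y\<^sub>p)\<^sup>2\<close> of the distance between user \<open>k\<close> and the waveguide,
  i.e. the line of all points \<open>(q, y\<^sub>p, d)\<close>.
\<close>

definition dist_sq :: "real \<Rightarrow> real \<Rightarrow> real ^ 3 \<Rightarrow> real" where
  "dist_sq d yp u = d\<^sup>2 + (u $ 2 - yp)\<^sup>2"

definition snr :: "real \<Rightarrow> real \<Rightarrow> real \<Rightarrow> real \<Rightarrow> real \<Rightarrow> real ^ 3 \<Rightarrow> real" where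
  "snr \<eta> \<sigma> d yp P u = P * \<eta> / (dist_sq d yp u * \<sigma>\<^sup>2)"

definition tdma_region ::
  "real \<Rightarrow> real \<Rightarrow> real \<Rightarrow> real \<Rightarrow> real \<Rightarrow> real \<Rightarrow> real ^ 3 \<Rightarrow> real ^ 3 \<Rightarrow> (real \<times> real) set" where
  "tdma_region \<eta> \<sigma> d yp P1 P2 u1 u2 =
     (\<Union>\<rho>\<in>{0..1}. {(R1, R2).
        0 \<le> R1 \<and> R1 \<le> \<rho> * log 2 (1 + snr \<eta> \<sigma> d yp P1 u1) \<and>
        0 \<le> R2 \<and> R2 \<le> (1 - \<rho>) * log 2 (1 + snr \<eta> \<sigma> d yp P2 u2)})"

text \<open>
  Rate of a user that occupies the fraction \<open>\<beta>\<close> of the bandwidth when the pinching antenna is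
  at \<open>q\<close>; thus \<open>\<beta> = \<rho>\<close> gives \<open>r\<^sub>1\<close> and \<open>\<beta> = 1 - \<rho>\<close> gives \<open>r\<^sub>2\<close>.
\<close>

definition fdma_rate ::
  "real \<Rightarrow> real \<Rightarrow> real \<Rightarrow> real \<Rightarrow> real \<Rightarrow> real ^ 3 \<Rightarrow> real \<Rightarrow> real \<Rightarrow> real" where
  "fdma_rate \<eta> \<sigma> d yp P u \<beta> q =
     (if \<beta> = 0 then 0
      else \<beta> * log 2 (1 + (\<eta> * P / (\<beta> * \<sigma>\<^sup>2)) / (dist_sq d yp u + (q - u $ 1)\<^sup>2)))"

definition fdma_region_at ::
  "real \<Rightarrow> real \<Rightarrow> real \<Rightarrow> real \<Rightarrow> real \<Rightarrow> real \<Rightarrow> real ^ 3 \<Rightarrow> real ^ 3 \<Rightarrow> real \<Rightarrow> (real \<times> real) set" where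
  "fdma_region_at \<eta> \<sigma> d yp P1 P2 u1 u2 q =
     (\<Union>\<rho>\<in>{0..1}. {(R1, R2).
        0 \<le> R1 \<and> R1 \<le> fdma_rate \<eta> \<sigma> d yp P1 u1 \<rho> q \<and>
        0 \<le> R2 \<and> R2 \<le> fdma_rate \<eta> \<sigma> d yp P2 u2 (1 - \<rho>) q})"

definition fdma_region ::
  "real \<Rightarrow> real \<Rightarrow> real \<Rightarrow> real \<Rightarrow> real \<Rightarrow> real \<Rightarrow> real ^ 3 \<Rightarrow> real ^ 3 \<Rightarrow> (real \<times> real) set" where
  "fdma_region \<eta> \<sigma> d yp P1 P2 u1 u2 =
     convex hull (\<Union>q\<in>{u1 $ 1..u2 $ 1}. fdma_region_at \<eta> \<sigma> d yp P1 P2 u1 u2 q)"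

end

theory Submission
  imports Defs
begin

text \<open>
  Time sharing is already contained in the convex hull: a TDMA point is
  \<open>\<rho> (a, 0) + (1 - \<rho>) (0, b)\<close>, where \<open>(a, 0)\<close> is achieved by giving the whole band to user 1
  with the antenna at \<open>q = x\<^sub>1\<close>, and \<open>(0, b)\<close> by giving it to user 2 with the antenna at
  \<open>q = x\<^sub>2\<close>.
\<close>

lemma user_location_nth_1: "user_location x y $ 1 = x"
  by (simp add: user_location_def)

lemma log_one_plus_snr_nonneg:
  assumes "\<eta> > 0" "P > 0"
  shows "0 \<le> log 2 (1 + snr \<eta> \<sigma> d yp P u)"
proof -
  have "0 \<le> snr \<eta> \<sigma> d yp P u"
    using assms by (simp add: snr_def dist_sq_def)
  then show ?thesis
    by (subst zero_le_log_cancel_iff) simp_all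
qed

text \<open>With the antenna level with the user the offset \<open>q - u $ 1\<close> vanishes, and
  for \<open>\<beta> = 1\<close> the noise power is unscaled, so the FDMA ratio reduces to
  \<open>snr\<close>.\<close>

lemma fdma_rate_full_band:
  "fdma_rate \<eta> \<sigma> d yp P u 1 (u $ 1) = log 2 (1 + snr \<eta> \<sigma> d yp P u)"
  by (simp add: fdma_rate_def snr_def mult.commute)

text \<open>Turns a rate below a time-shared bound into an exact multiple of an achievable rate, so
  that the convex combination hits the point itself. Take \<open>R / t\<close>, or 0 when
  \<open>t = 0\<close> forces \<open>R = 0\<close>.\<close>

lemma scaled_interval_witness:
  fixes R t A :: real
  assumes "0 \<le> R" "R \<le> t * A" "0 \<le> t" "0 \<le> A"
  obtains a where "0 \<le> a" "a \<le> A" "R = t * a"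
proof (cases "t = 0")
  case True
  with assms that[of 0] show ?thesis by simp
next
  case False
  with assms that[of "R / t"] show ?thesis
    by (simp add: field_simps)
qed

theorem theorem3:
  fixes \<eta> \<sigma> d P1 P2 yp x1 x2 y1 y2 :: real
  assumes "\<eta> > 0" and "\<sigma>\<^sup>2 > 0" and "d > 0" and "P1 > 0" and "P2 > 0"
    and "x1 \<le> x2"
  shows "tdma_region \<eta> \<sigma> d yp P1 P2 (user_location x1 y1) (user_location x2 y2)
       \<subseteq> fdma_region \<eta> \<sigma> d yp P1 P2 (user_location x1 y1) (user_location x2 y2)"
proof
  let ?u1 = "user_location x1 y1" and ?u2 = "user_location x2 y2"
  let ?A = "log 2 (1 + snr \<eta> \<sigma> d yp P1 ?u1)" and ?B = "log 2 (1 + snr \<eta> \<sigma> d yp P2 ?u2)"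
  let ?F = "\<Union>q\<in>{?u1 $ 1..?u2 $ 1}. fdma_region_at \<eta> \<sigma> d yp P1 P2 ?u1 ?u2 q"
  fix z
  assume "z \<in> tdma_region \<eta> \<sigma> d yp P1 P2 ?u1 ?u2"
  then obtain \<rho> R1 R2 where z: "z = (R1, R2)" and \<rho>: "0 \<le> \<rho>" "\<rho> \<le> 1"
    and R1: "0 \<le> R1" "R1 \<le> \<rho> * ?A" and R2: "0 \<le> R2" "R2 \<le> (1 - \<rho>) * ?B"
    by (auto simp: tdma_region_def)
  have A: "0 \<le> ?A" and B: "0 \<le> ?B"
    using log_one_plus_snr_nonneg assms by blast+
  obtain a where a: "0 \<le> a" "a \<le> ?A" "R1 = \<rho> * a"
    using scaled_interval_witness[OF R1 \<rho>(1) A] .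
  obtain b where b: "0 \<le> b" "b \<le> ?B" "R2 = (1 - \<rho>) * b"
    using scaled_interval_witness[OF R2 _ B] \<rho>(2) by auto
  have "(a, 0) \<in> fdma_region_at \<eta> \<sigma> d yp P1 P2 ?u1 ?u2 (?u1 $ 1)"
    unfolding fdma_region_at_def
    \<comment> \<open>With \<open>\<rho> = 1\<close> user 2 has share 0; the branch
      \<open>\<beta> = 0\<close> makes that rate 0, which admits the second coordinate 0.\<close>
    by (rule UN_I[of 1]) (use a in \<open>simp_all add: fdma_rate_full_band, simp add: fdma_rate_def\<close>)
  then have a_mem: "(a, 0) \<in> ?F"
    using \<open>x1 \<le> x2\<close> by (intro UN_I[of "?u1 $ 1"]) (simp_all add: user_location_nth_1)
  have "(0, b) \<in> fdma_region_at \<eta> \<sigma> d yp P1 P2 ?u1 ?u2 (?u2 $ 1)"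
    unfolding fdma_region_at_def
    \<comment> \<open>Symmetric choice: \<open>\<rho> = 0\<close> leaves user 2 the share 1.\<close>
    by (rule UN_I[of 0]) (use b in \<open>simp_all add: fdma_rate_full_band, simp add: fdma_rate_def\<close>)
  then have b_mem: "(0, b) \<in> ?F"
    using \<open>x1 \<le> x2\<close> by (intro UN_I[of "?u2 $ 1"]) (simp_all add: user_location_nth_1)
  \<comment> \<open>The two points may need different antenna positions; they can be mixed because
    the hull is taken after the union over \<open>q\<close>.\<close>
  have "\<rho> *\<^sub>R (a, 0) + (1 - \<rho>) *\<^sub>R (0, b) \<in> convex hull ?F"
    by (rule convexD[OF convex_convex_hull]) (use a_mem b_mem \<rho> in \<open>auto intro!: hull_inc\<close>)
  then show "z \<in> fdma_region \<eta> \<sigma> d yp P1 P2 ?u1 ?u2"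
    by (simp add: fdma_region_def z a(3) b(3))
qed

end
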